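(* For every real $\mu>-1$, the Bessel zeta function $\zeta_{\mu}(x)=\sum_{n=1}^{\infty}\frac{1}{j_{\mu,n}^x}$ is log-convex for $x>1$; that is, for all real $x,y>1$ and all $\lambda\in[0,1]$, $$\zeta_\mu(\lambda x+(1-\lambda)y)\leq \zeta_\mu(x)^{\lambda}\,\zeta_\mu(y)^{1-\lambda}.$$
   Context: For a real number $\mu>-1$, the Bessel function of the first kind of order $\mu$ is $$J_{\mu}(z)=\left(\frac{z}{2}\right)^{\mu}\sum_{k=0}^{\infty}\frac{(-1)^k}{\Gamma(\mu+k+1)k!}\left(\frac{z}{2}\right)^{2k}.$$ It has infinitely many positive real zeros, denoted $0<j_{\mu,1}<j_{\mu,2}<j_{\mu,3}<\cdots$. A positive function $f$ on a real interval $I$ is called log-convex on $I$ if $f(\lambda x+(1-\lambda)y)\leq f(x)^{\lambda}f(y)^{1-\lambda}$ for all $x,y\in I$ and $\lambda\in[0,1]$. *)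

theory Defs
  imports "HOL-Analysis.Analysis"
begin

text \<open>
  The Bessel function of the first kind, on the positive half-line only: the prefactor is
  the real \<open>powr\<close>, which is not the intended branch (or value) for \<open>z \<le> 0\<close>.
\<close>

definition bessel_J :: "real \<Rightarrow> real \<Rightarrow> real" where
  "bessel_J \<mu> z =
     (z / 2) powr \<mu> *
     (\<Sum>k. (-1) ^ k / (Gamma (\<mu> + real k + 1) * fact k) * (z / 2) ^ (2 * k))"

text \<open>
  The \<open>n\<close>-th positive zero \<open>j\<^sub>\<mu>\<^sub>,\<^sub>n\<close> in increasing order, numbered from \<open>n = 1\<close>: the positive zero \<open>z\<close>
  for which there are exactly \<open>n\<close> zeros in the interval from \<open>0\<close> (excluded) to \<open>z\<close> (included). For
  \<open>n \<ge> 1\<close> the cardinality condition forces that set of zeros to be finite, so there is at most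
  one such \<open>z\<close>. The value at \<open>n = 0\<close> is meaningless.
\<close>

definition bessel_zero :: "real \<Rightarrow> nat \<Rightarrow> real" where
  "bessel_zero \<mu> n =
     (THE z. 0 < z \<and> bessel_J \<mu> z = 0 \<and> card {t. 0 < t \<and> t \<le> z \<and> bessel_J \<mu> t = 0} = n)"

definition bessel_zeta :: "real \<Rightarrow> real \<Rightarrow> real" where
  "bessel_zeta \<mu> x = (\<Sum>n. 1 / bessel_zero \<mu> (Suc n) powr x)"

definition log_convex_on :: "real set \<Rightarrow> (real \<Rightarrow> real) \<Rightarrow> bool" where
  "log_convex_on I f \<longleftrightarrow>
     (\<forall>x\<in>I. 0 < f x) \<and>
     (\<forall>x\<in>I. \<forall>y\<in>I. \<forall>t\<in>{0..1}.
        f (t * x + (1 - t) * y) \<le> f x powr t * f y powr (1 - t))"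

end

theory Submission
  imports Defs "HOL-Complex_Analysis.Conformal_Mappings"
begin

text \<open>
  Once the series \<open>\<Sum>n. 1 / j\<^sub>n\<^sup>x\<close> is known to converge for \<open>x > 1\<close>, log-convexity is Hoelder's
  inequality: its terms satisfy
  \<open>j powr -(t x + (1 - t) y) = (j powr -x) powr t * (j powr -y) powr (1 - t)\<close>, and the sum of such
  products is at most the product of the powers of the two sums (\<open>Hoelder_suminf\<close>). The substance
  is therefore about the zeros: there are infinitely many, so that every \<open>j\<^sub>n\<close> exists, and \<open>j\<^sub>n\<close>
  grows at least linearly.

  Both facts come from Sturm's comparison theorem. The function \<open>u(z) = \<surd>z J\<^sub>\<mu>(z)\<close> solves
  \<open>u'' + (1 + (1/4 - \<mu>\<^sup>2)/z\<^sup>2) u = 0\<close> on the positive half-line (\<open>bessel_normal_ODE\<close>). For large \<open>z\<close> the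
  coefficient exceeds \<open>1/4\<close>, so \<open>u\<close> oscillates at least as fast as \<open>sin (z/2)\<close> and has arbitrarily
  large zeros (\<open>bessel_J_zero_beyond\<close>). To the right of the smallest zero the coefficient is below some
  \<open>\<omega>\<^sup>2\<close>, so \<open>u\<close> oscillates no faster than \<open>cos (\<omega> z)\<close> and consecutive zeros are at least \<open>\<pi>/\<omega>\<close> apart
  (\<open>bessel_J_zeros_separated\<close>). That there is a smallest zero, and that the zeros can be counted in
  increasing order, holds because \<open>z\<^sup>-\<^sup>\<mu> J\<^sub>\<mu>(z)\<close> extends to a nonconstant entire function, which has
  only finitely many zeros in each disc (\<open>finite_bessel_J_zeros\<close>).
\<close>

section \<open>Sturm comparison\<close>

lemma connected_nonzero_sign:
  fixes f :: "real \<Rightarrow> real"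
  assumes "connected S" "continuous_on S f" "\<And>x. x \<in> S \<Longrightarrow> f x \<noteq> 0"
  obtains \<sigma> :: real where "\<And>x. x \<in> S \<Longrightarrow> \<sigma> * f x > 0"
proof -
  have conn: "connected (f ` S)"
    by (rule connected_continuous_image) fact+
  have "(\<forall>x\<in>S. f x > 0) \<or> (\<forall>x\<in>S. f x < 0)"
  proof (rule ccontr)
    assume "\<not> ?thesis"
    then obtain x y where xy: "x \<in> S" "y \<in> S" "f x \<le> 0" "0 \<le> f y"
      by (meson not_less)
    have "0 \<in> f ` S"
      using connectedD_interval[OF conn, of "f x" "f y" 0] xy by blast
    with assms(3) show False by force
  qed
  then show thesis
    using that[of 1] that[of "-1"] by fastforce
qed

text \<open>
  The Wronskian \<open>W = u v' - u' v\<close> has derivative \<open>(q - p) u v > 0\<close>, so it increases strictly from \<open>a\<close>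
  to \<open>b\<close>. But \<open>v\<close> leaves the value \<open>0\<close> upwards at \<open>a\<close> and returns to it downwards at \<open>b\<close>, so
  \<open>W a = u a * v' a \<ge> 0\<close> and \<open>W b = u b * v' b \<le> 0\<close>.
\<close>

lemma Sturm_comparison_pos:
  fixes u v u' v' p q :: "real \<Rightarrow> real"
  assumes "a < b"
    and u: "\<And>x. x \<in> {a..b} \<Longrightarrow> (u has_real_derivative u' x) (at x)"
    and u': "\<And>x. x \<in> {a..b} \<Longrightarrow> (u' has_real_derivative - q x * u x) (at x)"
    and v: "\<And>x. x \<in> {a..b} \<Longrightarrow> (v has_real_derivative v' x) (at x)"
    and v': "\<And>x. x \<in> {a..b} \<Longrightarrow> (v' has_real_derivative - p x * v x) (at x)"
    and pq: "\<And>x. x \<in> {a<..<b} \<Longrightarrow> p x < q x"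
    and v_ends: "v a = 0" "v b = 0"
    and v_pos: "\<And>x. x \<in> {a<..<b} \<Longrightarrow> v x > 0"
    and u_pos: "\<And>x. x \<in> {a..b} \<Longrightarrow> u x > 0"
  shows False
proof -
  define W where "W = (\<lambda>x. u x * v' x - u' x * v x)"
  have W': "(W has_real_derivative (q x - p x) * (u x * v x)) (at x)" if "x \<in> {a..b}" for x
    unfolding W_def
    by (rule derivative_eq_intros u[OF that] u'[OF that] v[OF that] v'[OF that] refl)+
       (simp add: algebra_simps)
  have "W a < W b"
  proof (rule DERIV_pos_imp_increasing_open[OF \<open>a < b\<close>])
    fix x assume "a < x" "x < b"
    then have "(q x - p x) * (u x * v x) > 0"
      using pq[of x] u_pos[of x] v_pos[of x] by simp
    with W'[of x] \<open>a < x\<close> \<open>x < b\<close> show "\<exists>y. (W has_real_derivative y) (at x) \<and> 0 < y"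
      by auto
  next
    show "continuous_on {a..b} W"
      using W' by (meson DERIV_isCont continuous_at_imp_continuous_on)
  qed
  moreover have "v' a \<ge> 0"
  proof (rule ccontr)
    assume "\<not> v' a \<ge> 0"
    with DERIV_neg_dec_right[OF v[of a]] \<open>a < b\<close> obtain d where
      d: "d > 0" "\<And>h. 0 < h \<Longrightarrow> h < d \<Longrightarrow> v (a + h) < v a" by auto
    define h where "h = min d (b - a) / 2"
    have "0 < h" "h < d" "a + h < b"
      using \<open>a < b\<close> d(1) by (auto simp: h_def min_def field_simps)
    with d(2)[of h] v_pos[of "a + h"] v_ends show False by simp
  qed
  moreover have "v' b \<le> 0"
  proof (rule ccontr)
    assume "\<not> v' b \<le> 0"
    with DERIV_pos_inc_left[OF v[of b]] \<open>a < b\<close> obtain d where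
      d: "d > 0" "\<And>h. 0 < h \<Longrightarrow> h < d \<Longrightarrow> v (b - h) < v b" by auto
    define h where "h = min d (b - a) / 2"
    have "0 < h" "h < d" "a < b - h"
      using \<open>a < b\<close> d(1) by (auto simp: h_def min_def field_simps)
    with d(2)[of h] v_pos[of "b - h"] v_ends show False by simp
  qed
  ultimately have "u a * v' a < u b * v' b" "u a * v' a \<ge> 0" "u b * v' b \<le> 0"
    using u_pos[of a] u_pos[of b] v_ends \<open>a < b\<close>
    by (auto simp: W_def mult_nonneg_nonpos)
  then show False by linarith
qed

text \<open>
  If \<open>u\<close> had no zero, then \<open>u\<close> and \<open>v\<close> would each have a constant sign, and multiplying by constants
  would make both positive, against \<open>Sturm_comparison_pos\<close>.
\<close>

lemma Sturm_comparison:
  fixes u v u' v' p q :: "real \<Rightarrow> real"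
  assumes "a < b"
    and u: "\<And>x. x \<in> {a..b} \<Longrightarrow> (u has_real_derivative u' x) (at x)"
    and u': "\<And>x. x \<in> {a..b} \<Longrightarrow> (u' has_real_derivative - q x * u x) (at x)"
    and v: "\<And>x. x \<in> {a..b} \<Longrightarrow> (v has_real_derivative v' x) (at x)"
    and v': "\<And>x. x \<in> {a..b} \<Longrightarrow> (v' has_real_derivative - p x * v x) (at x)"
    and pq: "\<And>x. x \<in> {a<..<b} \<Longrightarrow> p x < q x"
    and v_ends: "v a = 0" "v b = 0"
    and v_nz: "\<And>x. x \<in> {a<..<b} \<Longrightarrow> v x \<noteq> 0"
  shows "\<exists>x\<in>{a..b}. u x = 0"
proof (rule ccontr)
  assume "\<not> ?thesis"
  then have u_nz: "\<And>x. x \<in> {a..b} \<Longrightarrow> u x \<noteq> 0" by blast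
  have cont_u: "continuous_on {a..b} u"
    using u by (meson DERIV_isCont continuous_at_imp_continuous_on)
  have cont_v: "continuous_on {a<..<b} v"
    using v by (meson DERIV_isCont atLeastAtMost_iff continuous_at_imp_continuous_on
        greaterThanLessThan_iff less_imp_le)
  obtain \<sigma> where \<sigma>: "\<And>x. x \<in> {a..b} \<Longrightarrow> \<sigma> * u x > 0"
    using connected_nonzero_sign[OF connected_Icc cont_u u_nz] by blast
  obtain \<tau> where \<tau>: "\<And>x. x \<in> {a<..<b} \<Longrightarrow> \<tau> * v x > 0"
    using connected_nonzero_sign[OF connected_Ioo cont_v v_nz] by blast
  show False
  proof (rule Sturm_comparison_pos[OF \<open>a < b\<close>, where p = p and q = q])
    fix x assume x: "x \<in> {a..b}"
    show "((\<lambda>x. \<sigma> * u x) has_real_derivative \<sigma> * u' x) (at x)"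
      by (rule DERIV_cmult u x)+
    show "((\<lambda>x. \<tau> * v x) has_real_derivative \<tau> * v' x) (at x)"
      by (rule DERIV_cmult v x)+
    show "((\<lambda>x. \<sigma> * u' x) has_real_derivative - q x * (\<sigma> * u x)) (at x)"
      using DERIV_cmult[OF u'[OF x], of \<sigma>] by (simp add: mult_ac)
    show "((\<lambda>x. \<tau> * v' x) has_real_derivative - p x * (\<tau> * v x)) (at x)"
      using DERIV_cmult[OF v'[OF x], of \<tau>] by (simp add: mult_ac)
  qed (use \<sigma> \<tau> pq v_ends in auto)
qed

section \<open>The Bessel equation\<close>

text \<open>
  The coefficients in powers of \<open>s = z\<^sup>2 / 4\<close>. In this variable the series is entire and even powers
  of \<open>z\<close> become ordinary powers.
\<close>

definition bessel_coeff :: "real \<Rightarrow> nat \<Rightarrow> real" where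
  "bessel_coeff \<mu> k = (-1) ^ k / (Gamma (\<mu> + real k + 1) * fact k)"

definition bessel_series :: "real \<Rightarrow> real \<Rightarrow> real" where
  "bessel_series \<mu> s = (\<Sum>k. bessel_coeff \<mu> k * s ^ k)"

text \<open>
  Up to the constant factor \<open>2\<^sup>\<mu>\<close> this is \<open>\<surd>z J\<^sub>\<mu>(z)\<close>. The factor \<open>\<surd>z\<close> removes the first-order term
  from Bessel's equation, which is the form that Sturm comparison needs.
\<close>

definition bessel_normal :: "real \<Rightarrow> real \<Rightarrow> real" where
  "bessel_normal \<mu> z = z powr (\<mu> + 1 / 2) * bessel_series \<mu> (z\<^sup>2 / 4)"

lemma bessel_coeff_0_nonzero:
  assumes "\<mu> > -1"
  shows "bessel_coeff \<mu> 0 \<noteq> 0"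
proof -
  have "Gamma (\<mu> + 1) > 0"
    using assms by (intro Gamma_real_pos) simp
  then show ?thesis by (simp add: bessel_coeff_def)
qed

lemma bessel_coeff_Suc:
  assumes "\<mu> > -1"
  shows "(\<mu> + real k + 1) * real (Suc k) * bessel_coeff \<mu> (Suc k) = - bessel_coeff \<mu> k"
proof -
  have pos: "\<mu> + real k + 1 > 0" using assms by simp
  then have "Gamma (\<mu> + real k + 1 + 1) = (\<mu> + real k + 1) * Gamma (\<mu> + real k + 1)"
    by (intro Gamma_plus1) (auto elim!: nonpos_Ints_cases)
  moreover have "Gamma (\<mu> + real k + 1) > 0"
    using pos by (rule Gamma_real_pos)
  ultimately show ?thesis
    using pos by (simp add: bessel_coeff_def add_ac divide_simps)
qed

text \<open>
  Stated for real and complex \<open>s\<close> alike: the real series solves the differential equation, the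
  complex one controls the zeros.
\<close>

lemma summable_bessel_coeff:
  fixes s :: "'a :: {real_normed_div_algebra, banach}"
  assumes "\<mu> > -1"
  shows "summable (\<lambda>k. of_real (bessel_coeff \<mu> k) * s ^ k)"
proof -
  define N where "N = nat \<lceil>2 * norm s\<rceil> + 1"
  have N: "real N \<ge> 2 * norm s" "N \<ge> 1"
    unfolding N_def by linarith+
  show ?thesis
  proof (rule summable_ratio_test[where c = "1 / 2" and N = N])
    fix k assume k: "N \<le> k"
    have k1: "real k \<ge> 1" "real k \<ge> 2 * norm s" using N k by linarith+
    define m where "m = (\<mu> + real k + 1) * real (Suc k)"
    have "m \<ge> 1 * real k" unfolding m_def
      by (rule mult_mono) (use assms k1 in auto)
    then have m: "m \<ge> 2 * norm s" "m > 0" using k1 by auto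
    have "m * bessel_coeff \<mu> (Suc k) = - bessel_coeff \<mu> k"
      unfolding m_def by (rule bessel_coeff_Suc[OF assms])
    then have "bessel_coeff \<mu> (Suc k) = - bessel_coeff \<mu> k / m"
      using m by (simp add: field_simps)
    then have "norm (of_real (bessel_coeff \<mu> (Suc k)) * s ^ Suc k)
        = (norm s / m) * norm (of_real (bessel_coeff \<mu> k) * s ^ k)"
      using m by (simp add: norm_mult norm_power norm_divide flip: of_real_divide)
    also have "\<dots> \<le> 1 / 2 * norm (of_real (bessel_coeff \<mu> k) * s ^ k)"
      using m by (intro mult_right_mono) (auto simp: field_simps)
    finally show "norm (of_real (bessel_coeff \<mu> (Suc k)) * s ^ Suc k)
        \<le> 1 / 2 * norm (of_real (bessel_coeff \<mu> k) * s ^ k)" .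
  qed simp
qed

text \<open>
  Comparing coefficients of \<open>s\<^sup>k\<close>, the equation \<open>s g'' + (\<mu> + 1) g' + g = 0\<close> says
  \<open>(k + 1)(\<mu> + k + 1) c\<^sub>k\<^sub>+\<^sub>1 + c\<^sub>k = 0\<close>, which is the recurrence of the coefficients.
\<close>

lemma bessel_series_ODE:
  assumes "\<mu> > -1"
  obtains g' g'' where
    "\<And>s. (bessel_series \<mu> has_real_derivative g' s) (at s)"
    "\<And>s. (g' has_real_derivative g'' s) (at s)"
    "\<And>s. s * g'' s + (\<mu> + 1) * g' s + bessel_series \<mu> s = 0"
proof -
  let ?c = "bessel_coeff \<mu>"
  define g' where "g' = (\<lambda>s. \<Sum>k. diffs ?c k * s ^ k)"
  define g'' where "g'' = (\<lambda>s. \<Sum>k. diffs (diffs ?c) k * s ^ k)"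
  have sum0: "summable (\<lambda>k. ?c k * s ^ k)" for s
    using summable_bessel_coeff[OF assms, of s] by simp
  have sum1: "summable (\<lambda>k. diffs ?c k * s ^ k)" for s
    by (rule termdiff_converges_all) (rule sum0)
  have sum2: "summable (\<lambda>k. diffs (diffs ?c) k * s ^ k)" for s
    by (rule termdiff_converges_all) (rule sum1)
  have 1: "(bessel_series \<mu> has_real_derivative g' s) (at s)" for s
    unfolding bessel_series_def[abs_def] g'_def
    by (rule termdiffs_strong_converges_everywhere) (rule sum0)
  have 2: "(g' has_real_derivative g'' s) (at s)" for s
    unfolding g'_def g''_def
    by (rule termdiffs_strong_converges_everywhere) (rule sum1)
  have 3: "s * g'' s + (\<mu> + 1) * g' s + bessel_series \<mu> s = 0" for s
  proof -
    \<comment> \<open>Reindexed by one, so that all three series are in the same powers; the term \<open>k = 0\<close> vanishes.\<close>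
    have shift: "(\<lambda>k. real k * diffs ?c k * s ^ k) sums (s * g'' s)"
    proof -
      have "(\<lambda>k. s * (diffs (diffs ?c) k * s ^ k)) sums (s * g'' s)"
        unfolding g''_def by (intro sums_mult summable_sums sum2)
      then have "(\<lambda>k. real (Suc k) * diffs ?c (Suc k) * s ^ Suc k) sums (s * g'' s)"
        by (simp add: diffs_def mult_ac)
      then show ?thesis
        by (subst (asm) sums_Suc_iff) simp
    qed
    have "(\<lambda>k. real k * diffs ?c k * s ^ k + (\<mu> + 1) * (diffs ?c k * s ^ k) + ?c k * s ^ k)
        sums (s * g'' s + (\<mu> + 1) * g' s + bessel_series \<mu> s)"
      unfolding g'_def bessel_series_def
      by (intro sums_add shift sums_mult summable_sums sum0 sum1)
    moreover have "real k * diffs ?c k * s ^ k + (\<mu> + 1) * (diffs ?c k * s ^ k) + ?c k * s ^ k = 0"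
      for k
    proof -
      have "real k * diffs ?c k * s ^ k + (\<mu> + 1) * (diffs ?c k * s ^ k) + ?c k * s ^ k
          = ((\<mu> + real k + 1) * real (Suc k) * ?c (Suc k) + ?c k) * s ^ k"
        by (simp add: diffs_def algebra_simps)
      then show ?thesis by (simp only: bessel_coeff_Suc[OF assms]) simp
    qed
    ultimately show ?thesis
      using sums_unique2[of "\<lambda>_. 0::real"] by auto
  qed
  from that[OF 1 2 3] show thesis .
qed

text \<open>
  With \<open>a = \<mu> + 1/2\<close> and \<open>s = z\<^sup>2/4\<close>, differentiating \<open>z\<^sup>a g(s)\<close> twice gives
  \<open>z\<^sup>a (a (a - 1) / z\<^sup>2 g + s g'' + (\<mu> + 1) g')\<close>. The last two terms equal \<open>- g\<close> by the equation of the
  series, and \<open>a (a - 1) = \<mu>\<^sup>2 - 1/4\<close>.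
\<close>

lemma bessel_normal_ODE:
  assumes "\<mu> > -1"
  obtains u' where
    "\<And>z. z > 0 \<Longrightarrow> (bessel_normal \<mu> has_real_derivative u' z) (at z)"
    "\<And>z. z > 0 \<Longrightarrow>
      (u' has_real_derivative - (1 + (1 / 4 - \<mu>\<^sup>2) / z\<^sup>2) * bessel_normal \<mu> z) (at z)"
proof -
  let ?g = "bessel_series \<mu>"
  define a where "a = \<mu> + 1 / 2"
  obtain g' g'' where
    g: "\<And>s. (?g has_real_derivative g' s) (at s)" and
    g': "\<And>s. (g' has_real_derivative g'' s) (at s)" and
    ode: "\<And>s. s * g'' s + (\<mu> + 1) * g' s + ?g s = 0"
    using bessel_series_ODE[OF assms] by blast
  have sq: "((\<lambda>z. z\<^sup>2 / 4) has_real_derivative z / 2) (at z)" for z :: real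
    by (auto intro!: derivative_eq_intros)
  have gs: "((\<lambda>z. ?g (z\<^sup>2 / 4)) has_real_derivative g' (z\<^sup>2 / 4) * (z / 2)) (at z)" for z
    by (rule DERIV_chain2[OF g sq])
  have gs': "((\<lambda>z. g' (z\<^sup>2 / 4)) has_real_derivative g'' (z\<^sup>2 / 4) * (z / 2)) (at z)" for z
    by (rule DERIV_chain2[OF g' sq])
  have pw: "((\<lambda>z. z powr r) has_real_derivative r * z powr (r - 1)) (at z)" if "z > 0" for z r :: real
    using has_real_derivative_powr[OF that, of r] .
  define u' where "u' = (\<lambda>z. a * z powr (a - 1) * ?g (z\<^sup>2 / 4) + z powr (a + 1) * g' (z\<^sup>2 / 4) / 2)"
  have 1: "(bessel_normal \<mu> has_real_derivative u' z) (at z)" if "z > 0" for z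
  proof -
    have "((\<lambda>z. z powr a * ?g (z\<^sup>2 / 4)) has_real_derivative
        a * z powr (a - 1) * ?g (z\<^sup>2 / 4) + g' (z\<^sup>2 / 4) * (z / 2) * z powr a) (at z)"
      by (rule DERIV_mult pw gs that)+
    moreover have "z powr (a + 1) = z * z powr a"
      using that by (simp add: powr_add)
    ultimately show ?thesis
      unfolding bessel_normal_def[abs_def] a_def[symmetric] u'_def
      by (simp add: mult_ac)
  qed
  have 2: "(u' has_real_derivative - (1 + (1 / 4 - \<mu>\<^sup>2) / z\<^sup>2) * bessel_normal \<mu> z) (at z)"
    if "z > 0" for z
  proof -
    let ?s = "z\<^sup>2 / 4"
    have p1: "z powr (a - 1 - 1) = z powr a / z\<^sup>2"
      using that powr_diff[of z a 2] by simp
    have p2: "z powr (a - 1) = z powr a / z"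
      using that by (simp add: powr_diff)
    have p3: "z powr (a + 1) = z powr a * z"
      using that by (simp add: powr_add)
    have "(u' has_real_derivative
        (a * ((a - 1) * z powr (a - 1 - 1)) * ?g ?s + g' ?s * (z / 2) * (a * z powr (a - 1)))
        + ((a + 1) * z powr (a + 1 - 1) * g' ?s + g'' ?s * (z / 2) * z powr (a + 1)) / 2) (at z)"
      unfolding u'_def
      by (rule DERIV_add DERIV_cdivide DERIV_mult DERIV_cmult pw gs gs' that)+
    also have "(a * ((a - 1) * z powr (a - 1 - 1)) * ?g ?s + g' ?s * (z / 2) * (a * z powr (a - 1)))
        + ((a + 1) * z powr (a + 1 - 1) * g' ?s + g'' ?s * (z / 2) * z powr (a + 1)) / 2
      = z powr a * (a * (a - 1) / z\<^sup>2 * ?g ?s + (?s * g'' ?s + (\<mu> + 1) * g' ?s))"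
      using that unfolding p1 p2 p3 by (simp add: field_simps power2_eq_square a_def)
    also have "?s * g'' ?s + (\<mu> + 1) * g' ?s = - ?g ?s"
      using ode[of ?s] by linarith
    also have "z powr a * (a * (a - 1) / z\<^sup>2 * ?g ?s + - ?g ?s)
      = - (1 + (1 / 4 - \<mu>\<^sup>2) / z\<^sup>2) * (z powr a * ?g ?s)"
      using that by (simp add: field_simps power2_eq_square a_def)
    finally show ?thesis
      unfolding bessel_normal_def a_def .
  qed
  from that[OF 1 2] show thesis .
qed

section \<open>Zeros\<close>

lemma bessel_J_zero_iff_series:
  assumes "z > 0"
  shows "bessel_J \<mu> z = 0 \<longleftrightarrow> bessel_series \<mu> (z\<^sup>2 / 4) = 0"
proof -
  have "bessel_J \<mu> z = (z / 2) powr \<mu> * bessel_series \<mu> (z\<^sup>2 / 4)"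
    by (simp add: bessel_J_def bessel_series_def bessel_coeff_def power_mult power_divide)
  with assms show ?thesis by simp
qed

lemma bessel_J_zero_iff_normal:
  assumes "z > 0"
  shows "bessel_J \<mu> z = 0 \<longleftrightarrow> bessel_normal \<mu> z = 0"
  using bessel_J_zero_iff_series[OF assms] assms by (simp add: bessel_normal_def)

text \<open>
  The map \<open>t \<mapsto> t\<^sup>2/4\<close> sends these zeros injectively to the zeros, in a closed disc, of the entire
  function defined by the same power series. That function is not constant: a constant solution of
  \<open>s g'' + (\<mu> + 1) g' + g = 0\<close> is zero, while the series is nonzero at \<open>0\<close>.
\<close>

lemma finite_bessel_J_zeros:
  assumes "\<mu> > -1"
  shows "finite {t. 0 < t \<and> t \<le> R \<and> bessel_J \<mu> t = 0}"
proof -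
  define G :: "complex \<Rightarrow> complex"
    where "G = (\<lambda>w. \<Sum>k. of_real (bessel_coeff \<mu> k) * w ^ k)"
  have summ: "summable (\<lambda>k. of_real (bessel_coeff \<mu> k) * w ^ k)" for w :: complex
    by (rule summable_bessel_coeff[OF assms])
  have holo: "G holomorphic_on UNIV"
  proof (rule holomorphic_onI)
    fix w
    have "(G has_field_derivative (\<Sum>k. diffs (\<lambda>k. of_real (bessel_coeff \<mu> k)) k * w ^ k)) (at w)"
      unfolding G_def by (rule termdiffs_strong_converges_everywhere) (rule summ)
    then show "G field_differentiable at w within UNIV"
      using field_differentiable_def by auto
  qed
  have G_real: "G (of_real s) = of_real (bessel_series \<mu> s)" for s
  proof -
    have "summable (\<lambda>k. bessel_coeff \<mu> k * s ^ k)"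
      using summable_bessel_coeff[OF assms, of s] by simp
    then show ?thesis
      by (simp add: G_def bessel_series_def suminf_of_real)
  qed
  have "G 0 = of_real (bessel_coeff \<mu> 0)"
    unfolding G_def by (rule powser_zero)
  then have G0: "G 0 \<noteq> 0"
    using bessel_coeff_0_nonzero[OF assms] by simp
  have nonconst: "\<not> G constant_on UNIV"
  proof
    assume "G constant_on UNIV"
    then have "G (of_real s) = G (of_real 0)" for s
      unfolding constant_on_def by auto
    then have const: "bessel_series \<mu> s = bessel_series \<mu> 0" for s
      using G_real by (metis of_real_eq_iff)
    obtain g' g'' where
      g: "\<And>s. (bessel_series \<mu> has_real_derivative g' s) (at s)" and
      g': "\<And>s. (g' has_real_derivative g'' s) (at s)" and
      ode: "\<And>s. s * g'' s + (\<mu> + 1) * g' s + bessel_series \<mu> s = 0"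
      using bessel_series_ODE[OF assms] by blast
    have "bessel_series \<mu> = (\<lambda>_. bessel_series \<mu> 0)"
      using const by blast
    then have "g' s = 0" for s
      using g[of s] by (metis DERIV_const DERIV_unique)
    with ode[of 0] have "bessel_series \<mu> 0 = 0" by simp
    with G0 G_real[of 0] show False by simp
  qed
  have "finite {w \<in> cball 0 (R\<^sup>2 / 4). G w = 0}"
    by (rule holomorphic_compact_finite_zeros[OF holo open_UNIV connected_UNIV compact_cball _ nonconst])
       simp
  then show ?thesis
  proof (rule inj_on_finite[rotated 2])
    show "inj_on (\<lambda>t. of_real (t\<^sup>2 / 4) :: complex) {t. 0 < t \<and> t \<le> R \<and> bessel_J \<mu> t = 0}"
      by (auto simp: inj_on_def simp del: of_real_divide of_real_power)
    show "(\<lambda>t. of_real (t\<^sup>2 / 4)) ` {t. 0 < t \<and> t \<le> R \<and> bessel_J \<mu> t = 0}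
        \<subseteq> {w \<in> cball 0 (R\<^sup>2 / 4). G w = 0}"
      by (auto simp: G_real bessel_J_zero_iff_series power_mono
          simp del: of_real_divide of_real_power)
  qed
qed

text \<open>
  Comparison with \<open>sin ((x - a) / 2)\<close>, which has consecutive zeros \<open>a\<close> and \<open>a + 2\<pi>\<close>, yields a zero in
  between as soon as \<open>1 + (1/4 - \<mu>\<^sup>2)/x\<^sup>2 > 1/4\<close> there.
\<close>

lemma bessel_J_zero_beyond:
  assumes "\<mu> > -1"
  shows "\<exists>z>R. z > 0 \<and> bessel_J \<mu> z = 0"
proof -
  obtain u' where
    u: "\<And>z. z > 0 \<Longrightarrow> (bessel_normal \<mu> has_real_derivative u' z) (at z)" and
    u': "\<And>z. z > 0 \<Longrightarrow>
      (u' has_real_derivative - (1 + (1 / 4 - \<mu>\<^sup>2) / z\<^sup>2) * bessel_normal \<mu> z) (at z)"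
    using bessel_normal_ODE[OF assms] by blast
  \<comment> \<open>The summands \<open>1 + 2 * \<bar>\<mu>\<bar>\<close> ensure \<open>4 * \<mu>\<^sup>2 < x\<^sup>2\<close> for \<open>x \<ge> a\<close>, which bounds the coefficient below.\<close>
  define a where "a = 1 + \<bar>R\<bar> + 2 * \<bar>\<mu>\<bar>"
  have a: "a > 0" "a > R" by (auto simp: a_def)
  have "\<exists>x\<in>{a..a + 2 * pi}. bessel_normal \<mu> x = 0"
  proof (rule Sturm_comparison[where p = "\<lambda>_. 1 / 4" and v = "\<lambda>x. sin ((x - a) / 2)"
        and v' = "\<lambda>x. cos ((x - a) / 2) / 2"])
    fix x assume "x \<in> {a..a + 2 * pi}"
    then have "x > 0" using a by auto
    then show "(bessel_normal \<mu> has_real_derivative u' x) (at x)"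
      "(u' has_real_derivative - (1 + (1 / 4 - \<mu>\<^sup>2) / x\<^sup>2) * bessel_normal \<mu> x) (at x)"
      by (rule u, rule u')
    show "((\<lambda>x. sin ((x - a) / 2)) has_real_derivative cos ((x - a) / 2) / 2) (at x)"
      by (auto intro!: derivative_eq_intros)
    show "((\<lambda>x. cos ((x - a) / 2) / 2) has_real_derivative - (1 / 4) * sin ((x - a) / 2)) (at x)"
      by (auto intro!: derivative_eq_intros)
  next
    fix x assume x: "x \<in> {a<..<a + 2 * pi}"
    then have "1 + 2 * \<bar>\<mu>\<bar> \<le> x" by (auto simp: a_def)
    then have "(1 + 2 * \<bar>\<mu>\<bar>)\<^sup>2 \<le> x\<^sup>2" by (intro power_mono) auto
    then have "4 * \<mu>\<^sup>2 < x\<^sup>2"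
      by (simp add: power2_eq_square algebra_simps)
    moreover have "x > 0" "0 \<le> \<mu>\<^sup>2" using x a by auto
    ultimately have "16 * \<mu>\<^sup>2 < 4 + 12 * x\<^sup>2" by linarith
    with \<open>x > 0\<close> show "1 / 4 < 1 + (1 / 4 - \<mu>\<^sup>2) / x\<^sup>2"
      by (simp add: field_simps)
    have "sin ((x - a) / 2) > 0"
      using x by (intro sin_gt_zero) auto
    then show "sin ((x - a) / 2) \<noteq> 0" by simp
  qed auto
  then obtain x where "x \<ge> a" "bessel_normal \<mu> x = 0" by auto
  with a bessel_J_zero_iff_normal[of x \<mu>] show ?thesis
    by (intro exI[of _ x]) auto
qed

text \<open>
  Here the Bessel function is the slower partner: if consecutive zeros \<open>a\<close>, \<open>b\<close> were closer than
  \<open>\<pi>/\<omega>\<close>, the cosine of frequency \<open>\<omega>\<close> centred at their midpoint would have a zero in \<open>[a, b]\<close>, yet it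
  is positive there. The bound \<open>r\<close> is needed because for \<open>\<bar>\<mu>\<bar> < 1/2\<close> the coefficient
  \<open>1 + (1/4 - \<mu>\<^sup>2)/z\<^sup>2\<close> is unbounded near \<open>0\<close>.
\<close>

lemma bessel_J_zeros_separated:
  assumes "\<mu> > -1" "r > 0"
  obtains \<delta> where "\<delta> > 0"
    "\<And>a b. r \<le> a \<Longrightarrow> a < b \<Longrightarrow> bessel_J \<mu> a = 0 \<Longrightarrow> bessel_J \<mu> b = 0 \<Longrightarrow>
      (\<And>t. a < t \<Longrightarrow> t < b \<Longrightarrow> bessel_J \<mu> t \<noteq> 0) \<Longrightarrow> b - a \<ge> \<delta>"
proof -
  obtain u' where
    u: "\<And>z. z > 0 \<Longrightarrow> (bessel_normal \<mu> has_real_derivative u' z) (at z)" and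
    u': "\<And>z. z > 0 \<Longrightarrow>
      (u' has_real_derivative - (1 + (1 / 4 - \<mu>\<^sup>2) / z\<^sup>2) * bessel_normal \<mu> z) (at z)"
    using bessel_normal_ODE[OF assms(1)] by blast
  \<comment> \<open>The constant \<open>2\<close> instead of \<open>1\<close> makes the comparison of the coefficients strict.\<close>
  define \<omega> where "\<omega> = sqrt (2 + \<bar>1 / 4 - \<mu>\<^sup>2\<bar> / r\<^sup>2)"
  have \<omega>2: "\<omega>\<^sup>2 = 2 + \<bar>1 / 4 - \<mu>\<^sup>2\<bar> / r\<^sup>2"
    unfolding \<omega>_def by (subst real_sqrt_pow2) auto
  have \<omega>: "\<omega> > 0"
    unfolding \<omega>_def by (simp add: add_pos_nonneg)
  show thesis
  proof (rule that[of "pi / \<omega>"])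
    show "pi / \<omega> > 0" using \<omega> by simp
  next
    fix a b
    assume ab: "r \<le> a" "a < b" "bessel_J \<mu> a = 0" "bessel_J \<mu> b = 0"
      and consecutive: "\<And>t. a < t \<Longrightarrow> t < b \<Longrightarrow> bessel_J \<mu> t \<noteq> 0"
    define m where "m = (a + b) / 2"
    show "b - a \<ge> pi / \<omega>"
    proof (rule ccontr)
      assume "\<not> b - a \<ge> pi / \<omega>"
      then have short: "\<omega> * (b - a) < pi" using \<omega> by (simp add: field_simps)
      \<comment> \<open>The faster partner \<open>u\<close> is the cosine, the slower one \<open>v\<close> the Bessel function.\<close>
      have "\<exists>x\<in>{a..b}. cos (\<omega> * (x - m)) = 0"
      proof (rule Sturm_comparison[where q = "\<lambda>_. \<omega>\<^sup>2" and v = "bessel_normal \<mu>"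
            and u' = "\<lambda>x. - \<omega> * sin (\<omega> * (x - m))"])
        fix x assume "x \<in> {a..b}"
        then have "x > 0" using ab assms by auto
        then show "(bessel_normal \<mu> has_real_derivative u' x) (at x)"
          "(u' has_real_derivative - (1 + (1 / 4 - \<mu>\<^sup>2) / x\<^sup>2) * bessel_normal \<mu> x) (at x)"
          by (rule u, rule u')
        show "((\<lambda>x. cos (\<omega> * (x - m))) has_real_derivative - \<omega> * sin (\<omega> * (x - m))) (at x)"
          by (auto intro!: derivative_eq_intros)
        show "((\<lambda>x. - \<omega> * sin (\<omega> * (x - m))) has_real_derivative
            - \<omega>\<^sup>2 * cos (\<omega> * (x - m))) (at x)"
          by (auto intro!: derivative_eq_intros simp: power2_eq_square)
      next
        fix x assume x: "x \<in> {a<..<b}"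
        then have "x > 0" "r \<le> x" using ab assms by auto
        then show "bessel_normal \<mu> x \<noteq> 0"
          using consecutive[of x] x bessel_J_zero_iff_normal[of x \<mu>] by auto
        have "(1 / 4 - \<mu>\<^sup>2) / x\<^sup>2 \<le> \<bar>1 / 4 - \<mu>\<^sup>2\<bar> / x\<^sup>2"
          by (intro divide_right_mono) auto
        also have "\<dots> \<le> \<bar>1 / 4 - \<mu>\<^sup>2\<bar> / r\<^sup>2"
          using \<open>r \<le> x\<close> \<open>r > 0\<close> by (intro divide_left_mono power_mono) auto
        finally show "1 + (1 / 4 - \<mu>\<^sup>2) / x\<^sup>2 < \<omega>\<^sup>2"
          unfolding \<omega>2 by linarith
      qed (use ab assms bessel_J_zero_iff_normal[of a \<mu>] bessel_J_zero_iff_normal[of b \<mu>] in auto)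
      then obtain x where x: "a \<le> x" "x \<le> b" "cos (\<omega> * (x - m)) = 0" by auto
      have "\<omega> * \<bar>x - m\<bar> \<le> \<omega> * ((b - a) / 2)"
        using x \<omega> by (intro mult_left_mono) (auto simp: m_def abs_le_iff field_simps)
      also have "\<dots> < pi / 2" using short by simp
      finally have "\<bar>\<omega> * (x - m)\<bar> < pi / 2"
        using \<omega> by (simp add: abs_mult)
      then have "cos (\<omega> * (x - m)) > 0"
        by (intro cos_gt_zero_pi) auto
      with x show False by simp
    qed
  qed
qed

section \<open>Counting a locally finite set of reals in increasing order\<close>

lemma nth_element_unique:
  fixes Z :: "real set"
  assumes fin: "\<And>R. finite {t \<in> Z. t \<le> R}"
    and "a \<in> Z" "b \<in> Z" "card {t \<in> Z. t \<le> a} = card {t \<in> Z. t \<le> b}"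
  shows "a = b"
proof -
  have "card {t \<in> Z. t \<le> x} < card {t \<in> Z. t \<le> y}" if "x < y" "y \<in> Z" for x y
  proof (rule psubset_card_mono[OF fin])
    have "y \<in> {t \<in> Z. t \<le> y} - {t \<in> Z. t \<le> x}" "{t \<in> Z. t \<le> x} \<subseteq> {t \<in> Z. t \<le> y}"
      using that by auto
    then show "{t \<in> Z. t \<le> x} \<subset> {t \<in> Z. t \<le> y}" by blast
  qed
  from this[of a b] this[of b a] assms(2-4) show ?thesis
    by (cases a b rule: linorder_cases) simp_all
qed

lemma next_element:
  fixes Z :: "real set"
  assumes fin: "\<And>R. finite {t \<in> Z. t \<le> R}" and unbounded: "\<And>R. \<exists>z\<in>Z. z > R"
  shows "\<exists>z\<in>Z. z > R \<and> {t \<in> Z. t \<le> z} = insert z {t \<in> Z. t \<le> R}"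
proof -
  obtain w where w: "w \<in> Z" "w > R" using unbounded by blast
  define A where "A = {t \<in> Z. R < t \<and> t \<le> w}"
  have A: "finite A" "A \<noteq> {}"
    using w by (auto simp: A_def intro: finite_subset[OF _ fin[of w]])
  define z where "z = Min A"
  have "z \<in> A" unfolding z_def using A by (rule Min_in)
  moreover have "t \<le> R" if "t \<in> Z" "t < z" for t
  proof (rule ccontr)
    assume "\<not> t \<le> R"
    then have "t \<in> A" using that \<open>z \<in> A\<close> by (auto simp: A_def)
    with that A show False by (auto simp: z_def)
  qed
  ultimately have z: "z \<in> Z" "z > R" "\<And>t. t \<in> Z \<Longrightarrow> t < z \<Longrightarrow> t \<le> R"
    by (simp_all add: A_def)
  have "t \<in> {t \<in> Z. t \<le> z} \<longleftrightarrow> t \<in> insert z {t \<in> Z. t \<le> R}" for t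
    using z(1,2) z(3)[of t] by (cases t z rule: linorder_cases) auto
  with z(1,2) show ?thesis by blast
qed

lemma nth_element_exists:
  fixes Z :: "real set"
  assumes fin: "\<And>R. finite {t \<in> Z. t \<le> R}" and unbounded: "\<And>R. \<exists>z\<in>Z. z > R"
    and pos: "\<And>z. z \<in> Z \<Longrightarrow> z > 0"
  shows "\<exists>z\<in>Z. card {t \<in> Z. t \<le> z} = Suc n"
proof (induction n)
  case 0
  have "{t \<in> Z. t \<le> 0} = {}" using pos by force
  with next_element[OF fin unbounded, of 0] obtain z where "z \<in> Z" "{t \<in> Z. t \<le> z} = {z}"
    by auto
  then show ?case by (intro bexI[of _ z]) simp_all
next
  case (Suc n)
  then obtain z where z: "z \<in> Z" "card {t \<in> Z. t \<le> z} = Suc n" by blast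
  obtain z' where z': "z' \<in> Z" "z' > z" "{t \<in> Z. t \<le> z'} = insert z' {t \<in> Z. t \<le> z}"
    using next_element[OF fin unbounded, of z] by blast
  have "card (insert z' {t \<in> Z. t \<le> z}) = Suc (Suc n)"
    using z(2) z'(2) by (subst card_insert_disjoint[OF fin]) simp_all
  with z' show ?case by (intro bexI[of _ z']) (simp_all only:)
qed

section \<open>The sequence of Bessel zeros\<close>

text \<open>
  The description in the definition of \<open>bessel_zero\<close> is satisfied by exactly one number, because the
  positive zeros form a locally finite and unbounded set.
\<close>

lemma bessel_zero_Suc:
  assumes "\<mu> > -1"
  shows "bessel_zero \<mu> (Suc n) > 0" "bessel_J \<mu> (bessel_zero \<mu> (Suc n)) = 0"
    "card {t. 0 < t \<and> t \<le> bessel_zero \<mu> (Suc n) \<and> bessel_J \<mu> t = 0} = Suc n"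
proof -
  define Z where "Z = {t. 0 < t \<and> bessel_J \<mu> t = 0}"
  have Z_le: "{t \<in> Z. t \<le> R} = {t. 0 < t \<and> t \<le> R \<and> bessel_J \<mu> t = 0}" for R
    by (auto simp: Z_def)
  have fin: "finite {t \<in> Z. t \<le> R}" for R
    unfolding Z_le by (rule finite_bessel_J_zeros[OF assms])
  have unbounded: "\<exists>z\<in>Z. z > R" for R
    using bessel_J_zero_beyond[OF assms, of R] by (auto simp: Z_def)
  have pos: "z > 0" if "z \<in> Z" for z
    using that by (simp add: Z_def)
  obtain z where z: "z \<in> Z" "card {t \<in> Z. t \<le> z} = Suc n"
    using nth_element_exists[of Z n, OF fin unbounded pos] by auto
  have unique: "\<exists>!z. z \<in> Z \<and> card {t \<in> Z. t \<le> z} = Suc n"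
  proof (rule ex1I)
    show "z \<in> Z \<and> card {t \<in> Z. t \<le> z} = Suc n" using z by blast
    show "w = z" if "w \<in> Z \<and> card {t \<in> Z. t \<le> w} = Suc n" for w
      by (rule nth_element_unique[OF fin]) (use that z in simp_all)
  qed
  have "bessel_zero \<mu> (Suc n) = (THE z. z \<in> Z \<and> card {t \<in> Z. t \<le> z} = Suc n)"
    unfolding bessel_zero_def Z_le by (simp only: Z_def mem_Collect_eq conj_assoc)
  with theI'[OF unique]
  have "bessel_zero \<mu> (Suc n) \<in> Z \<and> card {t \<in> Z. t \<le> bessel_zero \<mu> (Suc n)} = Suc n"
    by (simp only:)
  then show "bessel_zero \<mu> (Suc n) > 0" "bessel_J \<mu> (bessel_zero \<mu> (Suc n)) = 0"
    "card {t. 0 < t \<and> t \<le> bessel_zero \<mu> (Suc n) \<and> bessel_J \<mu> t = 0} = Suc n"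
    unfolding Z_le by (simp_all only: Z_def mem_Collect_eq)
qed

lemma bessel_zero_less_Suc:
  assumes "\<mu> > -1"
  shows "bessel_zero \<mu> (Suc n) < bessel_zero \<mu> (Suc (Suc n))"
proof (rule ccontr)
  let ?N = "\<lambda>x. {s. 0 < s \<and> s \<le> x \<and> bessel_J \<mu> s = 0}"
  assume "\<not> ?thesis"
  then have "?N (bessel_zero \<mu> (Suc (Suc n))) \<subseteq> ?N (bessel_zero \<mu> (Suc n))"
    by (intro Collect_mono) (meson le_less_trans linorder_not_less order_trans)
  from card_mono[OF finite_bessel_J_zeros[OF assms] this] show False
    unfolding bessel_zero_Suc(3)[OF assms] by simp
qed

text \<open>
  A zero strictly in between would force the number of zeros up to the endpoint to jump by at least
  two, but it jumps by one.
\<close>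

lemma no_zero_between_bessel_zeros:
  assumes "\<mu> > -1"
    and "bessel_zero \<mu> (Suc n) < t" "t < bessel_zero \<mu> (Suc (Suc n))"
  shows "bessel_J \<mu> t \<noteq> 0"
proof
  assume t: "bessel_J \<mu> t = 0"
  let ?N = "\<lambda>x. {s. 0 < s \<and> s \<le> x \<and> bessel_J \<mu> s = 0}"
  let ?a = "bessel_zero \<mu> (Suc n)" and ?b = "bessel_zero \<mu> (Suc (Suc n))"
  have fin: "finite (?N x)" for x
    by (rule finite_bessel_J_zeros[OF assms(1)])
  have a: "?a > 0" and b: "?b > 0" "bessel_J \<mu> ?b = 0"
    using bessel_zero_Suc[OF assms(1)] by blast+
  have "t \<in> ?N t - ?N ?a" "?b \<in> ?N ?b - ?N t"
    using a b t assms(2,3) by simp_all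
  moreover have "?N ?a \<subseteq> ?N t" "?N t \<subseteq> ?N ?b"
    using assms(2,3) by fastforce+
  ultimately have "?N ?a \<subset> ?N t" "?N t \<subset> ?N ?b"
    by blast+
  from this[THEN psubset_card_mono[OF fin]] show False
    unfolding bessel_zero_Suc(3)[OF assms(1)] by simp
qed

text \<open>
  All zeros lie to the right of the first one, so the separation constant for \<open>r = j\<^sub>1\<close> applies to every
  pair of consecutive zeros, and \<open>j\<^sub>n \<ge> j\<^sub>1 + (n - 1) \<delta> \<ge> n min {j\<^sub>1, \<delta>}\<close>.
\<close>

lemma bessel_zero_ge_linear:
  assumes "\<mu> > -1"
  obtains c where "c > 0" "\<And>n. bessel_zero \<mu> (Suc n) \<ge> c * real (Suc n)"
proof -
  let ?z = "\<lambda>n. bessel_zero \<mu> (Suc n)"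
  obtain \<delta> where \<delta>: "\<delta> > 0" and
    sep: "\<And>a b. ?z 0 \<le> a \<Longrightarrow> a < b \<Longrightarrow> bessel_J \<mu> a = 0 \<Longrightarrow> bessel_J \<mu> b = 0 \<Longrightarrow>
      (\<And>t. a < t \<Longrightarrow> t < b \<Longrightarrow> bessel_J \<mu> t \<noteq> 0) \<Longrightarrow> b - a \<ge> \<delta>"
    using bessel_J_zeros_separated[OF assms bessel_zero_Suc(1)[OF assms]] by blast
  define c where "c = min (?z 0) \<delta>"
  have lower: "?z 0 \<le> ?z n" for n
  proof (induction n)
    case (Suc n)
    then show ?case using bessel_zero_less_Suc[OF assms, of n] by linarith
  qed simp
  have gap: "?z (Suc n) - ?z n \<ge> c" for n
  proof -
    have "?z (Suc n) - ?z n \<ge> \<delta>"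
      by (rule sep lower bessel_zero_less_Suc bessel_zero_Suc(2) no_zero_between_bessel_zeros
          assms | assumption)+
    then show ?thesis by (simp add: c_def)
  qed
  have "?z n \<ge> c * real (Suc n)" for n
  proof (induction n)
    case 0
    then show ?case by (simp add: c_def)
  next
    case (Suc n)
    then show ?case using gap[of n] by (simp add: algebra_simps)
  qed
  moreover have "c > 0" using \<delta> bessel_zero_Suc(1)[OF assms] by (simp add: c_def)
  ultimately show thesis by (rule that[rotated])
qed

lemma summable_bessel_zeta:
  assumes "\<mu> > -1" "x > 1"
  shows "summable (\<lambda>n. 1 / bessel_zero \<mu> (Suc n) powr x)"
proof -
  obtain c where c: "c > 0" "\<And>n. bessel_zero \<mu> (Suc n) \<ge> c * real (Suc n)"
    using bessel_zero_ge_linear[OF assms(1)] by blast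
  have "summable (\<lambda>n. real n powr (- x))"
    using assms by (simp add: summable_real_powr_iff)
  then have "summable (\<lambda>n. c powr (- x) * real (Suc n) powr (- x))"
    by (intro summable_mult) (subst summable_Suc_iff)
  then show ?thesis
  proof (rule summable_comparison_test')
    fix n
    have "bessel_zero \<mu> (Suc n) powr (- x) \<le> (c * real (Suc n)) powr (- x)"
      using c assms by (intro powr_mono2') auto
    then show "norm (1 / bessel_zero \<mu> (Suc n) powr x) \<le> c powr (- x) * real (Suc n) powr (- x)"
      using c by (simp add: powr_minus_divide powr_mult)
  qed
qed

section \<open>Log-convexity\<close>

text \<open>
  Hoelder's inequality with exponents \<open>1/t\<close> and \<open>1/(1 - t)\<close>. After normalizing both sums to \<open>1\<close>,
  Young's inequality bounds each product by a convex combination of the two terms, and these bounds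
  sum to \<open>t + (1 - t) = 1\<close>. The weighted form also covers \<open>t = 0\<close> and \<open>t = 1\<close>.
\<close>

lemma Hoelder_suminf:
  fixes a b :: "nat \<Rightarrow> real"
  assumes a: "summable a" "\<And>n. a n > 0" and b: "summable b" "\<And>n. b n > 0"
    and t: "0 \<le> t" "t \<le> 1"
    and summ: "summable (\<lambda>n. a n powr t * b n powr (1 - t))"
  shows "(\<Sum>n. a n powr t * b n powr (1 - t)) \<le> suminf a powr t * suminf b powr (1 - t)"
proof -
  define A B where "A = suminf a" and "B = suminf b"
  have A: "A > 0" and B: "B > 0"
    unfolding A_def B_def using a b by (auto intro: suminf_pos)
  have "(\<lambda>n. A powr t * B powr (1 - t) * (t * (a n / A) + (1 - t) * (b n / B)))
      sums (A powr t * B powr (1 - t) * (t * (A / A) + (1 - t) * (B / B)))"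
    unfolding A_def B_def
    by (intro sums_mult sums_add sums_divide summable_sums a b)
  then have sums: "(\<lambda>n. A powr t * B powr (1 - t) * (t * (a n / A) + (1 - t) * (b n / B)))
      sums (A powr t * B powr (1 - t))"
    using A B by simp
  have le: "a n powr t * b n powr (1 - t)
      \<le> A powr t * B powr (1 - t) * (t * (a n / A) + (1 - t) * (b n / B))" for n
  proof -
    have "(a n / A) powr t * (b n / B) powr (1 - t) \<le> t * (a n / A) + (1 - t) * (b n / B)"
      using t a(2)[of n] b(2)[of n] A B by (intro Youngs_inequality_0) auto
    then have "A powr t * B powr (1 - t) * ((a n / A) powr t * (b n / B) powr (1 - t))
        \<le> A powr t * B powr (1 - t) * (t * (a n / A) + (1 - t) * (b n / B))"
      by (intro mult_left_mono) auto
    moreover have "A powr t * B powr (1 - t) * ((a n / A) powr t * (b n / B) powr (1 - t))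
        = a n powr t * b n powr (1 - t)"
      using a(2)[of n] b(2)[of n] A B by (simp add: powr_divide)
    ultimately show ?thesis by simp
  qed
  show ?thesis
    using sums_le[OF le summable_sums[OF summ] sums] by (simp add: A_def B_def)
qed

theorem lemma4p1:
  fixes \<mu> :: real
  assumes "\<mu> > -1"
  shows "log_convex_on {1<..} (bessel_zeta \<mu>)"
  unfolding log_convex_on_def
proof (intro conjI ballI)
  let ?a = "\<lambda>x n. 1 / bessel_zero \<mu> (Suc n) powr x"
  have pos: "?a x n > 0" for x n
    using bessel_zero_Suc(1)[OF assms, of n] by simp
  show "bessel_zeta \<mu> x > 0" if "x \<in> {1<..}" for x
    unfolding bessel_zeta_def using that
    by (intro suminf_pos summable_bessel_zeta assms pos) auto
  fix x y t :: real
  assume x: "x \<in> {1<..}" and y: "y \<in> {1<..}" and t: "t \<in> {0..1}"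
  have "t * x + (1 - t) * y > 1"
    using convexD[OF convex_real_interval(3), of x 1 y t "1 - t"] x y t by simp
  then have summ: "summable (?a (t * x + (1 - t) * y))"
    by (rule summable_bessel_zeta[OF assms])
  have interp: "?a (t * x + (1 - t) * y) = (\<lambda>n. ?a x n powr t * ?a y n powr (1 - t))"
    using bessel_zero_Suc(1)[OF assms]
    by (simp add: fun_eq_iff powr_divide powr_powr powr_add mult.commute)
  show "bessel_zeta \<mu> (t * x + (1 - t) * y) \<le> bessel_zeta \<mu> x powr t * bessel_zeta \<mu> y powr (1 - t)"
    unfolding bessel_zeta_def interp
    using x y t summ[unfolded interp]
    by (intro Hoelder_suminf summable_bessel_zeta assms pos) auto
qed

end
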